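(* Let $k\ge2$ and $\lambda_i=1/k$ for all $i\in[k]$. Let $t\in[k]$ be a fixed constant. Sample a subset $\mathcal{T}\subseteq[k]$ of cardinality $t$ uniformly at random among all such subsets, and let $$S_2^{\mathcal{T}}:=\Big\{\frac1t\sum_{i\in\mathcal{T}}\bm{x}_i:\ \bm{x}_i\in\Xi_i\ \text{for } i\in\mathcal{T}\Big\}.$$ Then $$\mathbb{E}_{\mathcal{T}}\big[v(S_2^{\mathcal{T}})\big]\le\Big(1+\frac{k-t}{t(k-1)}\Big)v^* .$$
   Context: Notation: $[k]=\{1,\dots,k\}$. For $i\in[k]$, $\mathbb{P}_i=\sum_{j\in[|\Xi_i|]}\hat p_{ij}\delta_{\hat{\bm{x}}_{ij}}$ is a probability measure supported on a nonempty finite set $\Xi_i=\{\hat{\bm{x}}_{ij}\}_j\subseteq\mathbb{R}^d$ with $|\Xi_i|\le n$. The barycenter value for weights $\lambda_1,\dots,\lambda_k\ge 0$ summing to $1$ is $v^*=\inf_{\mathbb{P}}\sum_{i\in[k]}\lambda_iW_2^2(\mathbb{P},\mathbb{P}_i)$, the infimum over Borel probability measures on $\mathbb{R}^d$ with finite second moment, where $W_2$ is the type-2 Wasserstein distance for the Euclidean norm. For a nonempty finite set $S\subseteq\mathbb{R}^d$ and $\vec{\bm{j}}=(j_1,\dots,j_k)$ with $j_i\in[|\Xi_i|]$, put $C_{\vec{\bm{j}}}(S)=\min_{\bm{w}\in S}\sum_{i\in[k]}\lambda_i\|\hat{\bm{x}}_{i,j_i}-\bm{w}\|_2^2$, and define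 $$v(S)=\max_{\bm\gamma}\Big\{\sum_{i\in[k]}\sum_{j\in[|\Xi_i|]}\hat p_{ij}\gamma_{ij}:\ C_{\vec{\bm{j}}}(S)-\sum_{i\in[k]}\gamma_{ij_i}\ge0\ \ \forall\,\vec{\bm{j}}\in\prod_{i\in[k]}[|\Xi_i|]\Big\}.$$ This is the linear-programming dual of (and has the same value as) the problem of minimizing $\sum_{\vec{\bm{j}}}C_{\vec{\bm{j}}}(S)\Pi_{\vec{\bm{j}}}$ over nonnegative tensors $\bm\Pi$ whose $i$-th marginal is $(\hat p_{ij})_j$ for every $i\in[k]$. *)

theory Defs
  imports "HOL-Probability.Probability"
begin

definition couplings :: "'a measure \<Rightarrow> 'b measure \<Rightarrow> ('a \<times> 'b) measure set" where
  "couplings P Q =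
     {\<pi>. prob_space \<pi> \<and> sets \<pi> = sets (P \<Otimes>\<^sub>M Q) \<and> distr \<pi> P fst = P \<and> distr \<pi> Q snd = Q}"

(* The optimal transport cost is formed in ennreal, so that the integral of a non-integrable cost is
   infinite. For P and Q with finite second moment the infimum is finite (product coupling), so the
   conversion to real loses nothing. *)
definition wasserstein2 :: "(real ^ 'd) measure \<Rightarrow> (real ^ 'd) measure \<Rightarrow> real" where
  "wasserstein2 P Q =
     sqrt (enn2real (INF \<pi> \<in> couplings P Q. \<integral>\<^sup>+ z. ennreal ((norm (fst z - snd z))\<^sup>2) \<partial>\<pi>))"

definition borel_probs_second_moment :: "(real ^ 'd) measure set" where
  "borel_probs_second_moment =
     {P. prob_space P \<and> sets P = sets borel \<and> integrable P (\<lambda>z. (norm z)\<^sup>2)}"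

definition dirac_mixture :: "nat \<Rightarrow> (nat \<Rightarrow> real) \<Rightarrow> (nat \<Rightarrow> real ^ 'd) \<Rightarrow> (real ^ 'd) measure" where
  "dirac_mixture m p x =
     measure_of UNIV (sets borel)
       (\<lambda>A. \<Sum>j = 1..m. ennreal (p j) * emeasure (return borel (x j)) A)"

lemma sets_dirac_mixture [simp, measurable_cong]:
  "sets (dirac_mixture m p x) = sets borel"
  using sets.sets_measure_of_eq[of borel] by (simp add: dirac_mixture_def)

lemma emeasure_dirac_mixture:
  fixes x :: "nat \<Rightarrow> real ^ 'd"
  assumes "A \<in> sets borel"
  shows "emeasure (dirac_mixture m p x) A = (\<Sum>j = 1..m. ennreal (p j) * indicator A (x j))"
proof -
  have "emeasure (dirac_mixture m p x) A =
      (\<Sum>j = 1..m. ennreal (p j) * emeasure (return borel (x j)) A)"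
  proof (rule emeasure_measure_of[OF dirac_mixture_def])
    show "positive (sets (dirac_mixture m p x))
        (\<lambda>A. \<Sum>j = 1..m. ennreal (p j) * emeasure (return borel (x j)) A)"
      by (simp add: positive_def)
    show "countably_additive (sets (dirac_mixture m p x))
        (\<lambda>A. \<Sum>j = 1..m. ennreal (p j) * emeasure (return borel (x j)) A)"
    proof (rule countably_additiveI)
      fix B :: "nat \<Rightarrow> (real ^ 'd) set"
      assume B: "range B \<subseteq> sets (dirac_mixture m p x)" "disjoint_family B"
      have "(\<Sum>n. \<Sum>j = 1..m. ennreal (p j) * emeasure (return borel (x j)) (B n)) =
          (\<Sum>j = 1..m. \<Sum>n. ennreal (p j) * emeasure (return borel (x j)) (B n))"
        by (rule suminf_sum) simp
      also have "\<dots> = (\<Sum>j = 1..m. ennreal (p j) * (\<Sum>n. emeasure (return borel (x j)) (B n)))"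
        by (simp only: ennreal_suminf_cmult)
      also have "\<dots> = (\<Sum>j = 1..m. ennreal (p j) * emeasure (return borel (x j)) (\<Union>n. B n))"
        using B by (intro sum.cong refl arg_cong2[where f = "(*)"] suminf_emeasure) auto
      finally show "(\<Sum>n. \<Sum>j = 1..m. ennreal (p j) * emeasure (return borel (x j)) (B n)) =
          (\<Sum>j = 1..m. ennreal (p j) * emeasure (return borel (x j)) (\<Union>n. B n))" .
    qed
  qed (simp_all add: assms)
  then show ?thesis by (simp only: emeasure_return[OF assms])
qed

(* Throughout, the k measures are indexed by {1..k} and the atoms x i j of the i-th one by {1..m i},
   with masses p i j. *)
definition barycenter_value ::
  "nat \<Rightarrow> (nat \<Rightarrow> real) \<Rightarrow> (nat \<Rightarrow> nat) \<Rightarrow> (nat \<Rightarrow> nat \<Rightarrow> real) \<Rightarrow> (nat \<Rightarrow> nat \<Rightarrow> real ^ 'd) \<Rightarrow> real"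
where
  "barycenter_value k lam m p x =
     (INF P \<in> borel_probs_second_moment.
        \<Sum>i = 1..k. lam i * (wasserstein2 P (dirac_mixture (m i) (p i) (x i)))\<^sup>2)"

definition cost_tensor ::
  "nat \<Rightarrow> (nat \<Rightarrow> real) \<Rightarrow> (nat \<Rightarrow> nat \<Rightarrow> real ^ 'd) \<Rightarrow> (real ^ 'd) set \<Rightarrow> (nat \<Rightarrow> nat) \<Rightarrow> real"
where
  "cost_tensor k lam x S j =
     Min ((\<lambda>w. \<Sum>i = 1..k. lam i * (norm (x i (j i) - w))\<^sup>2) ` S)"

definition dual_feasible ::
  "nat \<Rightarrow> (nat \<Rightarrow> real) \<Rightarrow> (nat \<Rightarrow> nat) \<Rightarrow> (nat \<Rightarrow> nat \<Rightarrow> real ^ 'd) \<Rightarrow> (real ^ 'd) set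
    \<Rightarrow> (nat \<Rightarrow> nat \<Rightarrow> real) set"
where
  "dual_feasible k lam m x S =
     {\<gamma>. \<forall>j \<in> (\<Pi>\<^sub>E i\<in>{1..k}. {1..m i}). cost_tensor k lam x S j - (\<Sum>i = 1..k. \<gamma> i (j i)) \<ge> 0}"

(* The supremum is the maximum of the linear program: for a finite nonempty S and probability vectors
   p i it is feasible and bounded, hence attains its optimum. *)
definition restricted_value ::
  "nat \<Rightarrow> (nat \<Rightarrow> real) \<Rightarrow> (nat \<Rightarrow> nat) \<Rightarrow> (nat \<Rightarrow> nat \<Rightarrow> real) \<Rightarrow> (nat \<Rightarrow> nat \<Rightarrow> real ^ 'd)
    \<Rightarrow> (real ^ 'd) set \<Rightarrow> real"
where
  "restricted_value k lam m p x S =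
     (SUP \<gamma> \<in> dual_feasible k lam m x S. \<Sum>i = 1..k. \<Sum>j = 1..m i. p i j * \<gamma> i j)"

definition mean_support :: "(nat \<Rightarrow> (real ^ 'd) set) \<Rightarrow> nat set \<Rightarrow> (real ^ 'd) set" where
  "mean_support \<Xi> T = {(1 / real (card T)) *\<^sub>R (\<Sum>i\<in>T. y i) | y. \<forall>i\<in>T. y i \<in> \<Xi> i}"

end

theory Submission
  imports Defs
begin

text \<open>
  Only weak duality is needed. For every sample \<open>T\<close> take a nearly optimal dual solution for
  \<open>mean_support \<Xi> T\<close> and average these over \<open>T\<close>. By the variance formula for sampling without
  replacement, the average \<open>\<gamma>\<close> satisfies \<open>\<Sum>i. \<gamma> i (j i) \<le> c * (\<Sum>i. lam i * |x i (j i) - z|^2)\<close>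
  for all \<open>j\<close> and all points \<open>z\<close>, where \<open>c\<close> is the claimed factor. After division by \<open>c\<close> the
  functions \<open>\<phi> i z = min\<^sub>j (|x i j - z|^2 - \<gamma> i j / lam i)\<close> therefore satisfy
  \<open>\<Sum>i. lam i * \<phi> i \<ge> 0\<close>, and integrating \<open>\<phi> i z + \<gamma> i j / lam i \<le> |x i j - z|^2\<close> against couplings
  bounds the dual objective by the barycenter objective of an arbitrary \<open>P\<close>, with no gluing of couplings.
\<close>

section \<open>Counting the samples that contain prescribed indices\<close>

text \<open>Removing \<open>F\<close> is a bijection onto the subsets of \<open>A - F\<close> of
  size \<open>t - card F\<close>, with inverse adding \<open>F\<close> back.\<close>

lemma card_supersets_of_card:
  assumes "finite A" "F \<subseteq> A" "card F \<le> t"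
  shows "card {T. T \<subseteq> A \<and> card T = t \<and> F \<subseteq> T} = (card A - card F) choose (t - card F)"
proof -
  have fF: "finite F" using assms finite_subset by blast
  have "bij_betw (\<lambda>T. T \<union> F) {T. T \<subseteq> A - F \<and> card T = t - card F}
      {T. T \<subseteq> A \<and> card T = t \<and> F \<subseteq> T}"
  proof (rule bij_betw_byWitness[where f' = "\<lambda>T. T - F"])
    show "(\<lambda>T. T \<union> F) ` {T. T \<subseteq> A - F \<and> card T = t - card F}
        \<subseteq> {T. T \<subseteq> A \<and> card T = t \<and> F \<subseteq> T}"
    proof clarsimp
      fix T assume T: "T \<subseteq> A - F" "card T = t - card F"
      have "finite T" using T(1) assms(1) finite_subset by blast
      with T fF have "card (T \<union> F) = card T + card F"
        by (intro card_Un_disjoint) auto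
      with T assms show "T \<subseteq> A \<and> F \<subseteq> A \<and> card (T \<union> F) = t" by auto
    qed
    show "(\<lambda>T. T - F) ` {T. T \<subseteq> A \<and> card T = t \<and> F \<subseteq> T}
        \<subseteq> {T. T \<subseteq> A - F \<and> card T = t - card F}"
      using fF by (auto simp: card_Diff_subset)
  qed auto
  then have "card {T. T \<subseteq> A \<and> card T = t \<and> F \<subseteq> T} = card {T. T \<subseteq> A - F \<and> card T = t - card F}"
    by (simp add: bij_betw_same_card)
  also have "\<dots> = card (A - F) choose (t - card F)"
    using assms(1) by (intro n_subsets) auto
  also have "card (A - F) = card A - card F"
    using fF assms by (simp add: card_Diff_subset)
  finally show ?thesis .
qed

text \<open>The absorption identity for binomial coefficients, applied to the superset count. The
  denominator is cleared so that the identity stays in the natural numbers; it says that an index is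
  sampled with probability t/k, where k is the size of \<open>A\<close>.\<close>

lemma card_subsets_containing:
  assumes "finite A" "i \<in> A" "1 \<le> t"
  shows "card A * card {T. T \<subseteq> A \<and> card T = t \<and> {i} \<subseteq> T} = t * (card A choose t)"
proof -
  obtain s where s: "t = Suc s" using assms(3) by (cases t) auto
  show ?thesis
    using card_supersets_of_card[of A "{i}" t] assms times_binomial_minus1_eq[of t "card A"]
    by simp
qed

text \<open>Two applications of absorption: a pair of distinct indices is sampled with probability
  t(t-1)/(k(k-1)).\<close>

lemma card_subsets_containing_pair:
  assumes "finite A" "i \<in> A" "j \<in> A" "i \<noteq> j" "1 \<le> t"
  shows "card A * (card A - 1) * card {T. T \<subseteq> A \<and> card T = t \<and> {i, j} \<subseteq> T}
    = t * (t - 1) * (card A choose t)"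
\<comment> \<open>The superset count requires \<open>card F \<le> t\<close>, which fails for a pair
  when \<open>t = 1\<close>. In that case no sample contains the pair and both sides are 0.\<close>
proof (cases "t = 1")
  case True
  have "\<not> (card T = 1 \<and> {i, j} \<subseteq> T)" for T
    using assms(4) by (auto simp: card_1_singleton_iff)
  then have none: "{T. T \<subseteq> A \<and> card T = t \<and> {i, j} \<subseteq> T} = {}"
    using True by blast
  show ?thesis unfolding none using True by simp
next
  case False
  then have t: "2 \<le> t" using assms by simp
  have "card A * ((card A - 1) * ((card A - 2) choose (t - 2)))
      = card A * ((t - 1) * ((card A - 1) choose (t - 1)))"
    using times_binomial_minus1_eq[of "t - 1" "card A - 1"] t by (simp add: numeral_2_eq_2)
  also have "\<dots> = (t - 1) * (t * (card A choose t))"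
    using times_binomial_minus1_eq[of t "card A"] t by (simp add: mult.left_commute)
  finally show ?thesis
    using card_supersets_of_card[of A "{i, j}" t] assms t
    by (simp add: mult_ac numeral_2_eq_2)
qed

section \<open>Variance of the mean under sampling without replacement\<close>

text \<open>The square expands into inner products weighted by the number of samples containing both
  indices. This weight takes one value on the diagonal and another off it, and for centered vectors
  the off-diagonal inner products sum to minus the diagonal ones.\<close>

lemma sum_over_subsets_norm_sum_sq:
  fixes y :: "'a \<Rightarrow> 'v::real_inner"
  assumes A: "finite A" "2 \<le> card A" and t: "1 \<le> t" "t \<le> card A" and y: "(\<Sum>i\<in>A. y i) = 0"
  shows "(\<Sum>T | T \<subseteq> A \<and> card T = t. (norm (\<Sum>i\<in>T. y i))\<^sup>2)
    = real (card A choose t) * (real t * (real (card A) - real t)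
        / (real (card A) * (real (card A) - 1))) * (\<Sum>i\<in>A. (norm (y i))\<^sup>2)"
proof -
  let ?S = "{T. T \<subseteq> A \<and> card T = t}"
  define k where "k = card A"
  define b where "b = real (k choose t)"
  have fS: "finite ?S" using A by simp
  have kk: "real k > 0" "real k - 1 > 0" using A by (auto simp: k_def)
  \<comment> \<open>\<open>c i j\<close> counts the samples containing both indices; \<alpha> is its
    value for \<open>i = j\<close>, where the pair collapses to a singleton, and \<beta> its value
    for distinct indices.\<close>
  define c where "c i j = real (card {T. T \<subseteq> A \<and> card T = t \<and> {i, j} \<subseteq> T})" for i j
  define \<alpha> where "\<alpha> = real t * b / real k"
  define \<beta> where "\<beta> = real t * (real t - 1) * b / (real k * (real k - 1))"
  have c1: "c i i = \<alpha>" if "i \<in> A" for i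
  proof -
    have "real k * c i i = real t * b"
      using card_subsets_containing[OF A(1) that t(1)] unfolding c_def b_def k_def
      by (simp flip: of_nat_mult)
    then show ?thesis using kk by (simp add: \<alpha>_def field_simps)
  qed
  have c2: "c i j = \<beta>" if "i \<in> A" "j \<in> A" "i \<noteq> j" for i j
  proof -
    have "real (k * (k - 1)) * c i j = real (t * (t - 1)) * b"
      using card_subsets_containing_pair[OF A(1) that t(1)] unfolding c_def b_def k_def
      by (simp only: flip: of_nat_mult)
    then have "real k * (real k - 1) * c i j = real t * (real t - 1) * b"
      using t A by (simp add: of_nat_diff k_def)
    then show ?thesis using kk by (simp add: \<beta>_def field_simps)
  qed
  \<comment> \<open>Indicators extend the inner sums from \<open>T\<close> to all of
    \<open>A\<close>, so that the sum over samples can be moved innermost.\<close>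
  have "(\<Sum>T\<in>?S. (norm (\<Sum>i\<in>T. y i))\<^sup>2)
      = (\<Sum>T\<in>?S. \<Sum>i\<in>A. \<Sum>j\<in>A. of_bool ({i, j} \<subseteq> T) * (y i \<bullet> y j))"
  proof (rule sum.cong[OF refl])
    fix T assume T: "T \<in> ?S"
    have "(norm (\<Sum>i\<in>T. y i))\<^sup>2 = (\<Sum>i\<in>T. \<Sum>j\<in>T. y i \<bullet> y j)"
      by (simp add: power2_norm_eq_inner inner_sum_left inner_sum_right) (rule sum.swap)
    also have "\<dots> = (\<Sum>i\<in>A. of_bool (i \<in> T) * (\<Sum>j\<in>A. of_bool (j \<in> T) * (y i \<bullet> y j)))"
      using T A by (simp add: sum.If_cases of_bool_def if_distrib if_distribR Int_absorb1 cong: if_cong)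
    also have "\<dots> = (\<Sum>i\<in>A. \<Sum>j\<in>A. of_bool ({i, j} \<subseteq> T) * (y i \<bullet> y j))"
      by (simp add: sum_distrib_left of_bool_conj mult.assoc)
    finally show "(norm (\<Sum>i\<in>T. y i))\<^sup>2
        = (\<Sum>i\<in>A. \<Sum>j\<in>A. of_bool ({i, j} \<subseteq> T) * (y i \<bullet> y j))" .
  qed
  also have "\<dots> = (\<Sum>i\<in>A. \<Sum>j\<in>A. \<Sum>T\<in>?S. of_bool ({i, j} \<subseteq> T) * (y i \<bullet> y j))"
    by (subst sum.swap, intro sum.cong refl, rule sum.swap)
  also have "\<dots> = (\<Sum>i\<in>A. \<Sum>j\<in>A. c i j * (y i \<bullet> y j))"
  proof (intro sum.cong refl)
    fix i j
    have "(\<Sum>T\<in>?S. of_bool ({i, j} \<subseteq> T) :: real) = real (card {T\<in>?S. {i, j} \<subseteq> T})"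
      using fS by (simp add: sum.If_cases of_bool_def Int_def)
    also have "{T\<in>?S. {i, j} \<subseteq> T} = {T. T \<subseteq> A \<and> card T = t \<and> {i, j} \<subseteq> T}" by auto
    finally show "(\<Sum>T\<in>?S. of_bool ({i, j} \<subseteq> T) * (y i \<bullet> y j)) = c i j * (y i \<bullet> y j)"
      by (simp only: c_def flip: sum_distrib_right)
  qed
  also have "\<dots> = (\<Sum>i\<in>A. (\<alpha> - \<beta>) * (norm (y i))\<^sup>2)"
  proof (rule sum.cong[OF refl])
    fix i assume i: "i \<in> A"
    have "(\<Sum>j\<in>A. c i j * (y i \<bullet> y j)) = \<alpha> * (y i \<bullet> y i) + (\<Sum>j\<in>A-{i}. \<beta> * (y i \<bullet> y j))"
      using i A c1 c2 by (subst sum.remove[of _ i]) (auto intro!: sum.cong)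
    \<comment> \<open>Adding the missing diagonal term with weight \<beta> completes the sum over
      \<open>A\<close>, which vanishes because the vectors are centered.\<close>
    also have "\<dots> = (\<alpha> - \<beta>) * (y i \<bullet> y i) + \<beta> * (y i \<bullet> (\<Sum>j\<in>A. y j))"
      using i A by (subst (2) sum.remove[of _ i])
        (auto simp: inner_sum_right inner_add_right sum_distrib_left algebra_simps)
    finally show "(\<Sum>j\<in>A. c i j * (y i \<bullet> y j)) = (\<alpha> - \<beta>) * (norm (y i))\<^sup>2"
      using y by (simp add: power2_norm_eq_inner)
  qed
  also have "\<dots> = (\<alpha> - \<beta>) * (\<Sum>i\<in>A. (norm (y i))\<^sup>2)" by (simp add: sum_distrib_left)
  also have "\<alpha> - \<beta> = b * (real t * (real k - real t) / (real k * (real k - 1)))"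
    using kk by (simp add: \<alpha>_def \<beta>_def divide_simps) (simp add: algebra_simps)
  finally show ?thesis by (simp add: b_def k_def)
qed

text \<open>The parallel axis identity: the cross terms cancel because deviations from the mean sum
  to 0.\<close>

lemma sum_norm_sq_about_mean:
  fixes x :: "'a \<Rightarrow> 'v::real_inner"
  assumes "finite A" "A \<noteq> {}"
  defines "\<mu> \<equiv> (1 / real (card A)) *\<^sub>R (\<Sum>i\<in>A. x i)"
  shows "(\<Sum>i\<in>A. (norm (x i - w))\<^sup>2)
    = (\<Sum>i\<in>A. (norm (x i - \<mu>))\<^sup>2) + real (card A) * (norm (\<mu> - w))\<^sup>2"
proof -
  have sum0: "(\<Sum>i\<in>A. x i - \<mu>) = 0"
    using assms by (simp add: sum_subtractf scaleR_conv_of_real sum_constant_scaleR)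
  have "(norm (x i - w))\<^sup>2 = (norm (x i - \<mu>))\<^sup>2 + (norm (\<mu> - w))\<^sup>2 + 2 * ((x i - \<mu>) \<bullet> (\<mu> - w))" for i
    using dot_norm[of "x i - \<mu>" "\<mu> - w"] by simp
  then have "(\<Sum>i\<in>A. (norm (x i - w))\<^sup>2) = (\<Sum>i\<in>A. (norm (x i - \<mu>))\<^sup>2)
      + real (card A) * (norm (\<mu> - w))\<^sup>2 + 2 * ((\<Sum>i\<in>A. x i - \<mu>) \<bullet> (\<mu> - w))"
    by (simp add: sum.distrib sum_distrib_left inner_sum_left)
  then show ?thesis by (simp only: sum0) simp
qed

text \<open>For each sample the parallel axis identity gives the cost about the full mean \<mu> plus
  k times the squared error of the sample mean. The variance formula evaluates the sum of these
  errors, and the cost about \<mu> is at most that about any \<open>z\<close>.\<close>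

lemma sum_over_subsets_cost_of_mean_le:
  fixes x :: "'a \<Rightarrow> 'v::real_inner"
  assumes A: "finite A" "2 \<le> card A" and t: "1 \<le> t" "t \<le> card A"
  shows "(\<Sum>T | T \<subseteq> A \<and> card T = t. \<Sum>i\<in>A. (norm (x i - (1 / real t) *\<^sub>R (\<Sum>j\<in>T. x j)))\<^sup>2)
    \<le> real (card A choose t) * (1 + (real (card A) - real t) / (real t * (real (card A) - 1)))
        * (\<Sum>i\<in>A. (norm (x i - z))\<^sup>2)"
proof -
  define k where "k = card A"
  define \<mu> where "\<mu> = (1 / real k) *\<^sub>R (\<Sum>i\<in>A. x i)"
  define V where "V = (\<Sum>i\<in>A. (norm (x i - \<mu>))\<^sup>2)"
  define b where "b = real (k choose t)"
  let ?S = "{T. T \<subseteq> A \<and> card T = t}"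
  have ne: "A \<noteq> {}" using A by auto
  have kk: "real k > 0" "real k - 1 > 0" "real t > 0" "real t \<le> real k" using A t by (auto simp: k_def)
  have about: "(\<Sum>i\<in>A. (norm (x i - w))\<^sup>2) = V + real k * (norm (\<mu> - w))\<^sup>2" for w
    using sum_norm_sq_about_mean[OF A(1) ne, of x w] by (simp add: V_def \<mu>_def k_def)
  have sum0: "(\<Sum>i\<in>A. x i - \<mu>) = 0"
    using kk by (simp add: \<mu>_def sum_subtractf sum_constant_scaleR k_def)
  \<comment> \<open>The error of the sample mean is, up to sign, 1/t times a sum of centered
    vectors, the form the variance formula expects.\<close>
  have dev: "(norm (\<mu> - (1 / real t) *\<^sub>R (\<Sum>j\<in>T. x j)))\<^sup>2
      = (norm (\<Sum>i\<in>T. x i - \<mu>))\<^sup>2 / (real t)\<^sup>2" if "T \<in> ?S" for T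
  proof -
    have "(\<Sum>i\<in>T. x i - \<mu>) = - real t *\<^sub>R (\<mu> - (1 / real t) *\<^sub>R (\<Sum>j\<in>T. x j))"
      using kk that by (simp add: sum_subtractf sum_constant_scaleR algebra_simps)
    then show ?thesis using kk by (simp add: power_mult_distrib)
  qed
  have "(\<Sum>T\<in>?S. \<Sum>i\<in>A. (norm (x i - (1 / real t) *\<^sub>R (\<Sum>j\<in>T. x j)))\<^sup>2)
      = (\<Sum>T\<in>?S. V + real k * ((norm (\<Sum>i\<in>T. x i - \<mu>))\<^sup>2 / (real t)\<^sup>2))"
    by (intro sum.cong refl) (simp only: about dev)
  also have "\<dots> = b * V + real k / (real t)\<^sup>2 * (\<Sum>T\<in>?S. (norm (\<Sum>i\<in>T. x i - \<mu>))\<^sup>2)"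
    using A by (simp add: sum.distrib sum_distrib_left n_subsets b_def k_def)
  also have "\<dots> = b * V + real k / (real t)\<^sup>2 * (b * (real t * (real k - real t)
        / (real k * (real k - 1))) * V)"
    using sum_over_subsets_norm_sum_sq[OF A t sum0] by (simp add: b_def k_def V_def)
  \<comment> \<open>The claimed factor arises here: k/t^2 times t(k-t)/(k(k-1)) is
    (k-t)/(t(k-1)).\<close>
  also have "\<dots> = b * (1 + (real k - real t) / (real t * (real k - 1))) * V"
    using kk by (simp add: divide_simps power2_eq_square) (simp add: algebra_simps)
  also have "\<dots> \<le> b * (1 + (real k - real t) / (real t * (real k - 1))) * (\<Sum>i\<in>A. (norm (x i - z))\<^sup>2)"
    using kk by (intro mult_left_mono) (auto simp: about[of z] b_def)
  finally show ?thesis by (simp add: b_def k_def)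
qed

section \<open>Finitely supported measures and their couplings\<close>

lemma space_dirac_mixture [simp]: "space (dirac_mixture m p x) = UNIV"
  by (simp add: dirac_mixture_def space_measure_of_conv)

lemma prob_space_dirac_mixture:
  fixes x :: "nat \<Rightarrow> real ^ 'd"
  assumes "\<And>j. j \<in> {1..m} \<Longrightarrow> p j \<ge> 0" "(\<Sum>j = 1..m. p j) = 1"
  shows "prob_space (dirac_mixture m p x)"
proof
  have "emeasure (dirac_mixture m p x) UNIV = ennreal (\<Sum>j = 1..m. p j)"
    using assms(1) by (subst emeasure_dirac_mixture) (auto intro: sum_ennreal)
  then show "emeasure (dirac_mixture m p x) (space (dirac_mixture m p x)) = 1"
    using assms(2) by simp
qed

lemma AE_dirac_mixture: "AE y in dirac_mixture m p x. y \<in> x ` {1..m}"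
proof (rule AE_I)
  show "{y \<in> space (dirac_mixture m p x). y \<notin> x ` {1..m}} \<subseteq> - x ` {1..m}" by auto
  have borel: "- x ` {1..m} \<in> sets borel"
    by (intro borel_open open_Compl finite_imp_closed) simp
  then show "- x ` {1..m} \<in> sets (dirac_mixture m p x)" by simp
  show "emeasure (dirac_mixture m p x) (- x ` {1..m}) = 0"
    by (subst emeasure_dirac_mixture[OF borel]) (auto simp: indicator_def)
qed

text \<open>Injectivity keeps the masses of different indices from adding up at one point.\<close>

lemma measure_dirac_mixture_singleton:
  fixes x :: "nat \<Rightarrow> real ^ 'd"
  assumes "\<And>j. j \<in> {1..m} \<Longrightarrow> p j \<ge> 0" "inj_on x {1..m}" "j \<in> {1..m}"
  shows "measure (dirac_mixture m p x) {x j} = p j"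
proof -
  have "emeasure (dirac_mixture m p x) {x j} = (\<Sum>i = 1..m. ennreal (p i) * indicator {x j} (x i))"
    by (rule emeasure_dirac_mixture) simp
  also have "\<dots> = (\<Sum>i = 1..m. if i = j then ennreal (p i) else 0)"
    using inj_on_eq_iff[OF assms(2) _ assms(3)] by (intro sum.cong refl) (simp add: indicator_def)
  also have "\<dots> = ennreal (p j)" using assms(3) by simp
  finally show ?thesis using assms by (simp add: measure_def)
qed

lemma pair_measure_in_couplings:
  assumes "prob_space P" "prob_space Q"
  shows "P \<Otimes>\<^sub>M Q \<in> couplings P Q"
proof -
  interpret P: prob_space P by fact
  interpret Q: prob_space Q by fact
  interpret PQ: pair_prob_space P Q ..
  have "distr (P \<Otimes>\<^sub>M Q) Q snd = Q"
  proof (rule measure_eqI)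
    fix A assume A: "A \<in> sets (distr (P \<Otimes>\<^sub>M Q) Q snd)"
    then have "emeasure (distr (P \<Otimes>\<^sub>M Q) Q snd) A = emeasure (P \<Otimes>\<^sub>M Q) (space P \<times> A)"
      by (auto simp: emeasure_distr space_pair_measure dest: sets.sets_into_space
          intro!: arg_cong2[where f = emeasure])
    with A show "emeasure (distr (P \<Otimes>\<^sub>M Q) Q snd) A = emeasure Q A"
      by (simp add: Q.emeasure_pair_measure_Times P.emeasure_space_1)
  qed simp
  then show ?thesis
    by (simp add: couplings_def Q.distr_pair_fst PQ.prob_space_axioms)
qed

text \<open>One marginal has a finite second moment and the other is concentrated on finitely many
  points, so the squared distance is dominated by an integrable function. This permits passing from
  the \<open>ennreal\<close> cost to a real integral.\<close>

lemma coupling_cost_finite: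
  fixes P :: "(real ^ 'd) measure" and x :: "nat \<Rightarrow> real ^ 'd"
  assumes P: "P \<in> borel_probs_second_moment"
    and p: "\<And>j. j \<in> {1..m} \<Longrightarrow> p j \<ge> 0" "(\<Sum>j = 1..m. p j) = 1"
    and \<pi>: "\<pi> \<in> couplings P (dirac_mixture m p x)"
  shows "(\<integral>\<^sup>+ z. ennreal ((norm (fst z - snd z))\<^sup>2) \<partial>\<pi>) < \<infinity>"
proof -
  let ?Q = "dirac_mixture m p x"
  interpret \<pi>: prob_space \<pi> using \<pi> by (simp add: couplings_def)
  have setsP [measurable_cong]: "sets P = sets borel" and intP: "integrable P (\<lambda>z. (norm z)\<^sup>2)"
    using P by (auto simp: borel_probs_second_moment_def)
  have sets\<pi> [measurable_cong]: "sets \<pi> = sets (P \<Otimes>\<^sub>M ?Q)"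
    and margs: "distr \<pi> P fst = P" "distr \<pi> ?Q snd = ?Q"
    using \<pi> by (auto simp: couplings_def)
  have fst [measurable]: "fst \<in> measurable \<pi> P" and snd [measurable]: "snd \<in> measurable \<pi> ?Q"
    by measurable
  \<comment> \<open>The sum over all atoms is a convenient common upper bound for their squared
    norms.\<close>
  define K where "K = (\<Sum>j = 1..m. (norm (x j))\<^sup>2)"
  have K: "0 \<le> K" by (simp add: K_def sum_nonneg)
  have "integrable \<pi> (\<lambda>z. (norm (fst z))\<^sup>2)"
    using integrable_distr[OF fst, of "\<lambda>z. (norm z)\<^sup>2"] intP margs by simp
  then have int: "integrable \<pi> (\<lambda>z. 2 * (norm (fst z))\<^sup>2 + 2 * K)" by simp
  have "AE z in \<pi>. snd z \<in> x ` {1..m}"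
    by (rule AE_distrD[OF snd]) (simp only: margs AE_dirac_mixture)
  then have "AE z in \<pi>. ennreal ((norm (fst z - snd z))\<^sup>2) \<le> ennreal (2 * (norm (fst z))\<^sup>2 + 2 * K)"
  proof eventually_elim
    case (elim z)
    then obtain j where "j \<in> {1..m}" "snd z = x j" by auto
    then have "(norm (snd z))\<^sup>2 \<le> K"
      using member_le_sum[of j "{1..m}" "\<lambda>j. (norm (x j))\<^sup>2"] by (simp add: K_def)
    \<comment> \<open>The parallelogram law with the nonnegative term for
      \<open>fst z + snd z\<close> dropped.\<close>
    moreover have "(norm (fst z - snd z))\<^sup>2 \<le> 2 * (norm (fst z))\<^sup>2 + 2 * (norm (snd z))\<^sup>2"
      using zero_le_power2[of "norm (fst z + snd z)"]
      by (simp add: power2_norm_eq_inner inner_add_left inner_add_right inner_diff_left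
          inner_diff_right inner_commute)
    ultimately show ?case by (intro ennreal_leI) linarith
  qed
  then have "(\<integral>\<^sup>+ z. ennreal ((norm (fst z - snd z))\<^sup>2) \<partial>\<pi>)
      \<le> (\<integral>\<^sup>+ z. ennreal (2 * (norm (fst z))\<^sup>2 + 2 * K) \<partial>\<pi>)"
    by (rule nn_integral_mono_AE)
  also have "\<dots> < \<infinity>"
    using int K by (subst nn_integral_eq_integral) auto
  finally show ?thesis .
qed

section \<open>Weak duality, first for one transport problem and then for the barycenter\<close>

text \<open>Weak Kantorovich duality: integrating the pointwise inequality against any coupling
  turns its left side into the marginal integrals, whatever the coupling.\<close>

lemma dual_le_wasserstein2_sq:
  fixes P :: "(real ^ 'd) measure" and x :: "nat \<Rightarrow> real ^ 'd"
  assumes P: "P \<in> borel_probs_second_moment"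
    and p: "\<And>j. j \<in> {1..m} \<Longrightarrow> p j \<ge> 0" "(\<Sum>j = 1..m. p j) = 1"
    and inj: "inj_on x {1..m}"
    and \<phi>: "integrable P \<phi>"
    and dual: "\<And>z j. j \<in> {1..m} \<Longrightarrow> \<phi> z + \<gamma> j \<le> (norm (x j - z))\<^sup>2"
  shows "integral\<^sup>L P \<phi> + (\<Sum>j = 1..m. p j * \<gamma> j) \<le> (wasserstein2 P (dirac_mixture m p x))\<^sup>2"
proof -
  let ?Q = "dirac_mixture m p x"
  let ?cost = "\<lambda>\<pi>. \<integral>\<^sup>+ z. ennreal ((norm (fst z - snd z))\<^sup>2) \<partial>\<pi>"
  define L where "L = integral\<^sup>L P \<phi> + (\<Sum>j = 1..m. p j * \<gamma> j)"
  interpret Q: prob_space ?Q using p by (rule prob_space_dirac_mixture)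
  have probP: "prob_space P" and setsP [measurable_cong]: "sets P = sets borel"
    using P by (auto simp: borel_probs_second_moment_def)
  \<comment> \<open>The potential \<gamma> lives on indices; \<open>g\<close> carries it to a
    function on the space, zero away from the atoms.\<close>
  define g where "g y = (\<Sum>j = 1..m. \<gamma> j * indicator {x j} y)" for y
  have g_x: "g (x j) = \<gamma> j" if "j \<in> {1..m}" for j
  proof -
    have "g (x j) = (\<Sum>i = 1..m. if i = j then \<gamma> i else 0)"
      unfolding g_def using inj_on_eq_iff[OF inj that]
      by (intro sum.cong refl) (auto simp: indicator_def)
    then show ?thesis using that by simp
  qed
  have int_g: "integrable ?Q g"
    unfolding g_def by (intro Bochner_Integration.integrable_sum integrable_mult_right
        integrable_real_indicator) (auto simp: Q.emeasure_finite less_top[symmetric])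
  have "integral\<^sup>L ?Q g = (\<Sum>j = 1..m. \<gamma> j * measure ?Q {x j})"
    unfolding g_def by (subst Bochner_Integration.integral_sum)
      (auto intro!: integrable_mult_right integrable_real_indicator
        simp: Q.emeasure_finite less_top[symmetric])
  also have "\<dots> = (\<Sum>j = 1..m. p j * \<gamma> j)"
  proof (rule sum.cong[OF refl])
    fix j assume j: "j \<in> {1..m}"
    have "measure ?Q {x j} = p j"
      using p(1) inj j by (rule measure_dirac_mixture_singleton)
    then show "\<gamma> j * measure ?Q {x j} = p j * \<gamma> j" by simp
  qed
  finally have integral_g: "integral\<^sup>L ?Q g = (\<Sum>j = 1..m. p j * \<gamma> j)" .
  have lower: "ennreal L \<le> ?cost \<pi>" if \<pi>: "\<pi> \<in> couplings P ?Q" for \<pi>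
  proof -
    have sets\<pi> [measurable_cong]: "sets \<pi> = sets (P \<Otimes>\<^sub>M ?Q)"
      and margs: "distr \<pi> P fst = P" "distr \<pi> ?Q snd = ?Q"
      using \<pi> by (auto simp: couplings_def)
    have fst [measurable]: "fst \<in> measurable \<pi> P" and snd [measurable]: "snd \<in> measurable \<pi> ?Q"
      by measurable
    have ints: "integrable \<pi> (\<lambda>z. \<phi> (fst z))" "integrable \<pi> (\<lambda>z. g (snd z))"
      using integrable_distr[OF fst, of \<phi>] integrable_distr[OF snd, of g] \<phi> int_g margs by simp_all
    have "integral\<^sup>L \<pi> (\<lambda>z. \<phi> (fst z)) = integral\<^sup>L P \<phi>"
      using integral_distr[OF fst, of \<phi>] \<phi> margs by simp
    moreover have "integral\<^sup>L \<pi> (\<lambda>z. g (snd z)) = integral\<^sup>L ?Q g"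
      using integral_distr[OF snd, of g] int_g margs by simp
    ultimately have L: "L = (\<integral>z. \<phi> (fst z) + g (snd z) \<partial>\<pi>)"
      using ints by (simp add: L_def integral_g)
    \<comment> \<open>The dual inequality is available only when the second coordinate is an atom,
      which holds almost surely by the second marginal.\<close>
    have "AE z in \<pi>. snd z \<in> x ` {1..m}"
      by (rule AE_distrD[OF snd]) (simp only: margs AE_dirac_mixture)
    then have le: "AE z in \<pi>. \<phi> (fst z) + g (snd z) \<le> (norm (fst z - snd z))\<^sup>2"
    proof eventually_elim
      case (elim z)
      then obtain j where j: "j \<in> {1..m}" "snd z = x j" by auto
      show ?case using dual[OF j(1), of "fst z"] j by (simp add: g_x norm_minus_commute)
    qed
    have meas: "(\<lambda>z. (norm (fst z - snd z))\<^sup>2) \<in> borel_measurable \<pi>" by measurable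
    have int_cost: "integrable \<pi> (\<lambda>z. (norm (fst z - snd z))\<^sup>2)"
      using coupling_cost_finite[OF P p \<pi>] meas by (intro integrableI_nonneg) auto
    have "L \<le> (\<integral>z. (norm (fst z - snd z))\<^sup>2 \<partial>\<pi>)"
      unfolding L using ints int_cost le by (intro integral_mono_AE) auto
    then show ?thesis using int_cost by (subst nn_integral_eq_integral) (auto intro: ennreal_leI)
  qed
  \<comment> \<open>Since \<open>enn2real\<close> sends infinity to 0, the lower bound survives the
    conversion only for a finite infimum; the product coupling certifies this. A negative
    \<open>L\<close> does no harm, as the converted infimum is nonnegative.\<close>
  have prod: "P \<Otimes>\<^sub>M ?Q \<in> couplings P ?Q"
    using probP Q.prob_space_axioms by (rule pair_measure_in_couplings)
  have "(INF \<pi> \<in> couplings P ?Q. ?cost \<pi>) \<le> ?cost (P \<Otimes>\<^sub>M ?Q)" by (rule INF_lower[OF prod])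
  also have "\<dots> < \<infinity>" by (rule coupling_cost_finite[OF P p prod])
  finally have fin: "(INF \<pi> \<in> couplings P ?Q. ?cost \<pi>) < \<infinity>" .
  have "ennreal L \<le> (INF \<pi> \<in> couplings P ?Q. ?cost \<pi>)" by (intro INF_greatest lower)
  then have "L \<le> enn2real (INF \<pi> \<in> couplings P ?Q. ?cost \<pi>)"
    using fin by (cases "INF \<pi> \<in> couplings P ?Q. ?cost \<pi>") (auto simp: ennreal_le_iff2)
  then show ?thesis by (simp add: wasserstein2_def L_def)
qed

text \<open>For each fixed \<open>P\<close>, weak duality is applied to every measure separately
  with the potentials \<phi>; the hypothesis on \<gamma> makes their weighted sum nonnegative, so it
  can be discarded after integration.\<close>

lemma dual_le_barycenter_value:
  fixes x :: "nat \<Rightarrow> nat \<Rightarrow> real ^ 'd"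
  assumes lam: "\<And>i. i \<in> {1..k} \<Longrightarrow> lam i > 0"
    and m: "\<And>i. i \<in> {1..k} \<Longrightarrow> 1 \<le> m i"
    and inj: "\<And>i. i \<in> {1..k} \<Longrightarrow> inj_on (x i) {1..m i}"
    and p: "\<And>i j. i \<in> {1..k} \<Longrightarrow> j \<in> {1..m i} \<Longrightarrow> p i j \<ge> 0"
      "\<And>i. i \<in> {1..k} \<Longrightarrow> (\<Sum>j = 1..m i. p i j) = 1"
    and \<gamma>: "\<And>j z. j \<in> (\<Pi>\<^sub>E i\<in>{1..k}. {1..m i}) \<Longrightarrow>
      (\<Sum>i = 1..k. \<gamma> i (j i)) \<le> (\<Sum>i = 1..k. lam i * (norm (x i (j i) - z))\<^sup>2)"
  shows "(\<Sum>i = 1..k. \<Sum>j = 1..m i. p i j * \<gamma> i j) \<le> barycenter_value k lam m p x"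
  unfolding barycenter_value_def
proof (rule cINF_greatest)
  \<comment> \<open>A real infimum is bounded below in this way only over a nonempty set; the point
    mass at the origin is a candidate.\<close>
  have "return borel 0 \<in> (borel_probs_second_moment :: (real ^ 'd) measure set)"
    by (auto simp: borel_probs_second_moment_def prob_space_return nn_integral_return intro!: integrableI_bounded)
  then show "(borel_probs_second_moment :: (real ^ 'd) measure set) \<noteq> {}" by blast
next
  fix P :: "(real ^ 'd) measure"
  assume P: "P \<in> borel_probs_second_moment"
  then interpret P: prob_space P by (simp add: borel_probs_second_moment_def)
  have setsP [measurable_cong]: "sets P = sets borel" and intP: "integrable P (\<lambda>z. (norm z)\<^sup>2)"
    using P by (auto simp: borel_probs_second_moment_def)
  \<comment> \<open>\<phi> is the c-transform of the rescaled potential; dividing by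
    \<open>lam i\<close> is undone by the weight of the i-th transport cost.\<close>
  define q where "q i j z = (norm (x i j - z))\<^sup>2 - \<gamma> i j / lam i" for i j z
  define \<phi> where "\<phi> i z = (MIN j\<in>{1..m i}. q i j z)" for i z
  have int_sq: "integrable P (\<lambda>z. (norm (a - z))\<^sup>2)" for a
  proof (rule Bochner_Integration.integrable_bound)
    show "integrable P (\<lambda>z. 2 * (norm a)\<^sup>2 + 2 * (norm z)\<^sup>2)" using intP by simp
    have "(norm (a - z))\<^sup>2 \<le> 2 * (norm a)\<^sup>2 + 2 * (norm z)\<^sup>2" for z
      using zero_le_power2[of "norm (a + z)"]
      by (simp add: power2_norm_eq_inner inner_add_left inner_add_right inner_diff_left
          inner_diff_right inner_commute)
    then show "AE z in P. norm ((norm (a - z))\<^sup>2) \<le> norm (2 * (norm a)\<^sup>2 + 2 * (norm z)\<^sup>2)" by simp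
  qed measurable
  have int_\<phi>: "integrable P (\<phi> i)" if "i \<in> {1..k}" for i
    unfolding \<phi>_def[abs_def] q_def using m[OF that] int_sq by (intro integrable_MIN) auto
  have "(\<Sum>i = 1..k. lam i * \<phi> i z) \<ge> 0" for z
  proof -
    \<comment> \<open>Choosing for each \<open>i\<close> an index that attains the minimum at this
      \<open>z\<close> produces the tuple to which the hypothesis on \<gamma> is applied.\<close>
    have "\<exists>j\<in>{1..m i}. \<phi> i z = q i j z" if "i \<in> {1..k}" for i
    proof -
      have "\<phi> i z \<in> (\<lambda>j. q i j z) ` {1..m i}"
        unfolding \<phi>_def using m[OF that] by (intro Min_in) auto
      then show ?thesis by blast
    qed
    then have "\<forall>i\<in>{1..k}. \<exists>j. j \<in> {1..m i} \<and> \<phi> i z = q i j z" by blast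
    from bchoice[OF this] obtain j
      where j: "\<And>i. i \<in> {1..k} \<Longrightarrow> j i \<in> {1..m i} \<and> \<phi> i z = q i (j i) z"
      by blast
    \<comment> \<open>The chosen indices are arbitrary outside \<open>{1..k}\<close>, whereas the
      product set contains only extensional functions, hence \<open>restrict\<close>.\<close>
    have "(\<Sum>i = 1..k. \<gamma> i (j i)) \<le> (\<Sum>i = 1..k. lam i * (norm (x i (j i) - z))\<^sup>2)"
      using \<gamma>[of "restrict j {1..k}" z] j by (simp add: PiE_iff)
    moreover have "(\<Sum>i = 1..k. lam i * \<phi> i z)
        = (\<Sum>i = 1..k. lam i * (norm (x i (j i) - z))\<^sup>2 - \<gamma> i (j i))"
      using lam j by (intro sum.cong refl) (simp add: q_def right_diff_distrib less_imp_neq[symmetric])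
    ultimately show ?thesis by (simp add: sum_subtractf)
  qed
  then have "0 \<le> (\<integral>z. (\<Sum>i = 1..k. lam i * \<phi> i z) \<partial>P)" by (intro integral_nonneg_AE) simp
  also have "\<dots> = (\<Sum>i = 1..k. lam i * integral\<^sup>L P (\<phi> i))"
    using int_\<phi> by (subst Bochner_Integration.integral_sum) auto
  finally have "(\<Sum>i = 1..k. \<Sum>j = 1..m i. p i j * \<gamma> i j)
      \<le> (\<Sum>i = 1..k. lam i * integral\<^sup>L P (\<phi> i) + (\<Sum>j = 1..m i. p i j * \<gamma> i j))"
    by (simp add: sum.distrib)
  also have "\<dots> \<le> (\<Sum>i = 1..k. lam i * (wasserstein2 P (dirac_mixture (m i) (p i) (x i)))\<^sup>2)"
  proof (rule sum_mono)
    fix i assume i: "i \<in> {1..k}"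
    have "integral\<^sup>L P (\<phi> i) + (\<Sum>j = 1..m i. p i j * (\<gamma> i j / lam i))
        \<le> (wasserstein2 P (dirac_mixture (m i) (p i) (x i)))\<^sup>2"
    proof (rule dual_le_wasserstein2_sq[OF P])
      fix z j assume "j \<in> {1..m i}"
      then have "\<phi> i z \<le> q i j z" unfolding \<phi>_def by (intro Min_le) auto
      then show "\<phi> i z + \<gamma> i j / lam i \<le> (norm (x i j - z))\<^sup>2" by (simp add: q_def)
    qed (use i p inj int_\<phi> in auto)
    then have "lam i * (integral\<^sup>L P (\<phi> i) + (\<Sum>j = 1..m i. p i j * (\<gamma> i j / lam i)))
        \<le> lam i * (wasserstein2 P (dirac_mixture (m i) (p i) (x i)))\<^sup>2"
      using lam[OF i] by (intro mult_left_mono) auto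
    moreover have "lam i * (\<Sum>j = 1..m i. p i j * (\<gamma> i j / lam i)) = (\<Sum>j = 1..m i. p i j * \<gamma> i j)"
      using lam[OF i] by (simp add: sum_distrib_left)
    ultimately show "lam i * integral\<^sup>L P (\<phi> i) + (\<Sum>j = 1..m i. p i j * \<gamma> i j)
        \<le> lam i * (wasserstein2 P (dirac_mixture (m i) (p i) (x i)))\<^sup>2"
      by (simp add: distrib_left)
  qed
  finally show "(\<Sum>i = 1..k. \<Sum>j = 1..m i. p i j * \<gamma> i j)
      \<le> (\<Sum>i = 1..k. lam i * (wasserstein2 P (dirac_mixture (m i) (p i) (x i)))\<^sup>2)" .
qed

section \<open>The restricted linear program: finite supports and near-optimal dual
  solutions\<close>

lemma finite_mean_support:
  assumes "finite T" "\<And>i. i \<in> T \<Longrightarrow> finite (\<Xi> i)"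
  shows "finite (mean_support \<Xi> T)"
proof -
  have "mean_support \<Xi> T \<subseteq> (\<lambda>y. (1 / real (card T)) *\<^sub>R (\<Sum>i\<in>T. y i)) ` (\<Pi>\<^sub>E i\<in>T. \<Xi> i)"
  proof
    fix w assume "w \<in> mean_support \<Xi> T"
    then obtain y where y: "w = (1 / real (card T)) *\<^sub>R (\<Sum>i\<in>T. y i)" "\<forall>i\<in>T. y i \<in> \<Xi> i"
      unfolding mean_support_def by blast
    then show "w \<in> (\<lambda>y. (1 / real (card T)) *\<^sub>R (\<Sum>i\<in>T. y i)) ` (\<Pi>\<^sub>E i\<in>T. \<Xi> i)"
      by (intro image_eqI[of _ _ "restrict y T"]) auto
  qed
  then show ?thesis using assms by (meson finite_PiE finite_imageI finite_subset)
qed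

lemma zero_dual_feasible:
  assumes "\<And>i. i \<in> {1..k} \<Longrightarrow> lam i \<ge> 0" "finite S" "S \<noteq> {}"
  shows "(\<lambda>i j. 0) \<in> dual_feasible k lam m x S"
  using assms by (auto simp: dual_feasible_def cost_tensor_def intro!: sum_nonneg)

text \<open>A value below the supremum is exceeded by some feasible point; the zero potential makes
  the set of objective values nonempty.\<close>

lemma exists_near_optimal_dual:
  assumes "\<And>i. i \<in> {1..k} \<Longrightarrow> lam i \<ge> 0" "finite S" "S \<noteq> {}" "\<epsilon> > 0"
  shows "\<exists>\<gamma>\<in>dual_feasible k lam m x S.
    restricted_value k lam m p x S - \<epsilon> < (\<Sum>i = 1..k. \<Sum>j = 1..m i. p i j * \<gamma> i j)"
proof -
  have "\<exists>v\<in>(\<lambda>\<gamma>. \<Sum>i = 1..k. \<Sum>j = 1..m i. p i j * \<gamma> i j) ` dual_feasible k lam m x S.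
      restricted_value k lam m p x S - \<epsilon> < v"
  proof (rule less_cSupD)
    have "(\<lambda>i j. 0) \<in> dual_feasible k lam m x S"
      using assms(1-3) by (rule zero_dual_feasible)
    then show "(\<lambda>\<gamma>. \<Sum>i = 1..k. \<Sum>j = 1..m i. p i j * \<gamma> i j) ` dual_feasible k lam m x S \<noteq> {}"
      by blast
  qed (use assms(4) in \<open>simp add: restricted_value_def\<close>)
  then show ?thesis by blast
qed

section \<open>Averaging dual solutions over all samples\<close>

theorem theorem4:
  fixes k n t :: nat
    and lam :: "nat \<Rightarrow> real"
    and m :: "nat \<Rightarrow> nat"
    and p :: "nat \<Rightarrow> nat \<Rightarrow> real"
    and x :: "nat \<Rightarrow> nat \<Rightarrow> real ^ 'd"
    and \<Xi> :: "nat \<Rightarrow> (real ^ 'd) set"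
  assumes "k \<ge> 2"
    and "\<And>i. i \<in> {1..k} \<Longrightarrow> lam i = 1 / real k"
    and "\<And>i. i \<in> {1..k} \<Longrightarrow> 1 \<le> m i \<and> m i \<le> n"
    and "\<And>i. i \<in> {1..k} \<Longrightarrow> inj_on (x i) {1..m i}"
    and "\<And>i. i \<in> {1..k} \<Longrightarrow> \<Xi> i = x i ` {1..m i}"
    and "\<And>i j. i \<in> {1..k} \<Longrightarrow> j \<in> {1..m i} \<Longrightarrow> p i j \<ge> 0"
    and "\<And>i. i \<in> {1..k} \<Longrightarrow> (\<Sum>j = 1..m i. p i j) = 1"
    and "t \<in> {1..k}"
  shows "measure_pmf.expectation (pmf_of_set {T. T \<subseteq> {1..k} \<and> card T = t})
           (\<lambda>T. restricted_value k lam m p x (mean_support \<Xi> T))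
         \<le> (1 + (real k - real t) / (real t * (real k - 1))) * barycenter_value k lam m p x"
proof -
  note k = assms(1) and lam = assms(2) and m = assms(3) and inj = assms(4) and \<Xi> = assms(5)
    and p = assms(6,7) and t = assms(8)
  define c where "c = 1 + (real k - real t) / (real t * (real k - 1))"
  define b where "b = real (k choose t)"
  let ?I = "{T. T \<subseteq> {1..k} \<and> card T = t}"
  let ?v = "\<lambda>T. restricted_value k lam m p x (mean_support \<Xi> T)"
  have c: "c > 0" unfolding c_def using k t by (intro add_pos_nonneg divide_nonneg_nonneg) auto
  have b: "b > 0" unfolding b_def using t by simp
  have card_I: "card ?I = k choose t" using n_subsets[of "{1..k}" t] by simp
  have fin_I: "finite ?I" by simp
  have ne_I: "?I \<noteq> {}" using card_I b by (metis b_def card.empty less_irrefl of_nat_0)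
  have lam_pos: "lam i > 0" if "i \<in> {1..k}" for i using lam[OF that] k by simp
  have fin: "finite (mean_support \<Xi> T)" if "T \<in> ?I" for T
    using that \<Xi> finite_subset[of T "{1..k}"] by (intro finite_mean_support) auto
  have mean: "(1 / real t) *\<^sub>R (\<Sum>i\<in>T. x i (j i)) \<in> mean_support \<Xi> T"
    if "T \<in> ?I" "j \<in> (\<Pi>\<^sub>E i\<in>{1..k}. {1..m i})" for T j
  proof -
    have "\<forall>i\<in>T. x i (j i) \<in> \<Xi> i" using that \<Xi> by (fastforce simp: PiE_iff)
    then show ?thesis using that(1) unfolding mean_support_def by blast
  qed
  \<comment> \<open>The tuple taking the first atom of every measure is a witness, as each support
    has at least one atom.\<close>
  have ne: "mean_support \<Xi> T \<noteq> {}" if "T \<in> ?I" for T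
    using mean[OF that, of "\<lambda>i\<in>{1..k}. 1"] m by (auto simp: PiE_iff)
  have "(\<Sum>T\<in>?I. ?v T) / b \<le> c * barycenter_value k lam m p x"
  proof (rule field_le_epsilon)
    fix \<epsilon> :: real assume \<epsilon>: "\<epsilon> > 0"
    have "\<forall>T\<in>?I. \<exists>\<gamma>. \<gamma> \<in> dual_feasible k lam m x (mean_support \<Xi> T) \<and>
        ?v T - \<epsilon> < (\<Sum>i = 1..k. \<Sum>j = 1..m i. p i j * \<gamma> i j)"
    proof
      fix T assume T: "T \<in> ?I"
      have "\<exists>\<gamma>\<in>dual_feasible k lam m x (mean_support \<Xi> T).
          ?v T - \<epsilon> < (\<Sum>i = 1..k. \<Sum>j = 1..m i. p i j * \<gamma> i j)"
        using lam_pos fin[OF T] ne[OF T] \<epsilon> by (intro exists_near_optimal_dual) (auto intro: less_imp_le)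
      then show "\<exists>\<gamma>. \<gamma> \<in> dual_feasible k lam m x (mean_support \<Xi> T) \<and>
          ?v T - \<epsilon> < (\<Sum>i = 1..k. \<Sum>j = 1..m i. p i j * \<gamma> i j)"
        by blast
    qed
    from bchoice[OF this] obtain \<gamma> where
      feas: "\<And>T. T \<in> ?I \<Longrightarrow> \<gamma> T \<in> dual_feasible k lam m x (mean_support \<Xi> T)" and
      near: "\<And>T. T \<in> ?I \<Longrightarrow> ?v T - \<epsilon> < (\<Sum>i = 1..k. \<Sum>j = 1..m i. p i j * \<gamma> T i j)"
      by blast
    \<comment> \<open>Division by \<open>b\<close>, the number of samples, averages the dual
      solutions; division by \<open>c\<close> restores feasibility for the unrestricted
      problem.\<close>
    define \<gamma>' where "\<gamma>' i j = (\<Sum>T\<in>?I. \<gamma> T i j) / (b * c)" for i j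
    have "(\<Sum>i = 1..k. \<Sum>j = 1..m i. p i j * \<gamma>' i j) \<le> barycenter_value k lam m p x"
    proof (rule dual_le_barycenter_value)
      fix j z assume j: "j \<in> (\<Pi>\<^sub>E i\<in>{1..k}. {1..m i})"
      have "(\<Sum>i = 1..k. \<gamma> T i (j i))
          \<le> 1 / real k * (\<Sum>i = 1..k. (norm (x i (j i) - (1 / real t) *\<^sub>R (\<Sum>l\<in>T. x l (j l))))\<^sup>2)"
        if T: "T \<in> ?I" for T
      proof -
        have "(\<Sum>i = 1..k. \<gamma> T i (j i)) \<le> cost_tensor k lam x (mean_support \<Xi> T) j"
          using feas[OF T] j by (auto simp: dual_feasible_def)
        \<comment> \<open>The minimum is bounded by its value at the mean, over \<open>T\<close>, of
          the very points selected by \<open>j\<close>; this choice ties the cost to the sampling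
          estimate.\<close>
        also have "\<dots> \<le> (\<Sum>i = 1..k. lam i
            * (norm (x i (j i) - (1 / real t) *\<^sub>R (\<Sum>l\<in>T. x l (j l))))\<^sup>2)"
          unfolding cost_tensor_def using fin[OF T] mean[OF T j] by (intro Min_le) auto
        finally show ?thesis using lam by (simp add: sum_distrib_left)
      qed
      then have "(\<Sum>T\<in>?I. \<Sum>i = 1..k. \<gamma> T i (j i)) \<le> (\<Sum>T\<in>?I. 1 / real k
          * (\<Sum>i = 1..k. (norm (x i (j i) - (1 / real t) *\<^sub>R (\<Sum>l\<in>T. x l (j l))))\<^sup>2))"
        by (rule sum_mono)
      also have "\<dots> = 1 / real k * (\<Sum>T\<in>?I.
          \<Sum>i = 1..k. (norm (x i (j i) - (1 / real t) *\<^sub>R (\<Sum>l\<in>T. x l (j l))))\<^sup>2)"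
        by (simp only: sum_distrib_left)
      \<comment> \<open>The sampling estimate for the k points selected by \<open>j\<close>, with
        the arbitrary \<open>z\<close> as reference point.\<close>
      also have "\<dots> \<le> 1 / real k * (b * c * (\<Sum>i = 1..k. (norm (x i (j i) - z))\<^sup>2))"
        using sum_over_subsets_cost_of_mean_le[of "{1..k}" t "\<lambda>i. x i (j i)" z] k t
        by (intro mult_left_mono) (simp_all add: b_def c_def)
      also have "\<dots> = b * c * (\<Sum>i = 1..k. lam i * (norm (x i (j i) - z))\<^sup>2)"
        using lam by (simp add: sum_distrib_left mult_ac)
      finally have "(\<Sum>T\<in>?I. \<Sum>i = 1..k. \<gamma> T i (j i)) / (b * c)
          \<le> (\<Sum>i = 1..k. lam i * (norm (x i (j i) - z))\<^sup>2)"
        using b c by (simp add: pos_divide_le_eq mult.commute)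
      moreover have "(\<Sum>i = 1..k. \<gamma>' i (j i)) = (\<Sum>T\<in>?I. \<Sum>i = 1..k. \<gamma> T i (j i)) / (b * c)"
        unfolding \<gamma>'_def by (subst sum.swap) (simp add: sum_divide_distrib)
      ultimately show "(\<Sum>i = 1..k. \<gamma>' i (j i)) \<le> (\<Sum>i = 1..k. lam i * (norm (x i (j i) - z))\<^sup>2)"
        by simp
    qed (use lam_pos m inj p in auto)
    moreover have "(\<Sum>i = 1..k. \<Sum>j = 1..m i. p i j * \<gamma>' i j)
        = (\<Sum>T\<in>?I. \<Sum>i = 1..k. \<Sum>j = 1..m i. p i j * \<gamma> T i j) / (b * c)"
    proof -
      have "(\<Sum>T\<in>?I. \<Sum>i = 1..k. \<Sum>j = 1..m i. p i j * \<gamma> T i j)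
          = (\<Sum>i = 1..k. \<Sum>j = 1..m i. \<Sum>T\<in>?I. p i j * \<gamma> T i j)"
        by (subst sum.swap, intro sum.cong refl, rule sum.swap)
      then show ?thesis by (simp add: \<gamma>'_def sum_divide_distrib sum_distrib_left)
    qed
    ultimately have "(\<Sum>T\<in>?I. \<Sum>i = 1..k. \<Sum>j = 1..m i. p i j * \<gamma> T i j)
        \<le> b * (c * barycenter_value k lam m p x)"
      using b c by (simp add: pos_divide_le_eq mult_ac)
    moreover have "(\<Sum>T\<in>?I. ?v T - \<epsilon>) \<le> (\<Sum>T\<in>?I. \<Sum>i = 1..k. \<Sum>j = 1..m i. p i j * \<gamma> T i j)"
      using near by (intro sum_mono less_imp_le)
    \<comment> \<open>The slack is incurred once per sample, hence \<open>b\<close> times in total,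
      and becomes a single \<epsilon> after averaging.\<close>
    moreover have "(\<Sum>T\<in>?I. ?v T - \<epsilon>) = (\<Sum>T\<in>?I. ?v T) - b * \<epsilon>"
      by (simp only: sum_subtractf sum_constant card_I b_def)
    ultimately have "(\<Sum>T\<in>?I. ?v T) \<le> b * (c * barycenter_value k lam m p x + \<epsilon>)"
      unfolding distrib_left by linarith
    then show "(\<Sum>T\<in>?I. ?v T) / b \<le> c * barycenter_value k lam m p x + \<epsilon>"
      using b by (simp add: pos_divide_le_eq mult.commute)
  qed
  then show ?thesis
    by (simp only: integral_pmf_of_set[OF ne_I fin_I] card_I b_def c_def)
qed

end
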